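(* Let $\{T_\theta\}_{\theta\in U}$ satisfy the standing assumptions (i)–(iv) of the context. Suppose $\mathrm{tag}(\bar\theta)=(0,\mathrm{fin})$, let $\{\theta_\varepsilon^{c}\}_{\varepsilon\downarrow0}$ be a center family, and take the petal family $\theta_\varepsilon^{p}\equiv\bar\theta$. Suppose $V_\varepsilon^{c}\to F$ as $\varepsilon\downarrow0$ in the Painlevé–Kuratowski sense, where $F$ is a (nonempty) proper face of the closed convex set $\mathrm{Fix}(T_{\bar\theta})$. Let $\mathcal S_\varepsilon\equiv\mathcal S\subset\mathrm{Fix}(T_{\bar\theta})$ be nonempty and bounded with $\inf_{z\in\mathcal S}\mathrm{dist}_{\mathcal H}(z,F)>0$. Then $\{\mathcal S_\varepsilon\}_{\varepsilon\downarrow0}$ is an afterimage slow region family for $\{\theta_\varepsilon^{c}\}_{\varepsilon\downarrow0}$ with respect to $\{\theta_\varepsilon^{p}\}_{\varepsilon\downarrow0}$, and its vanishing modulus satisfies $\rho_\varepsilon=O(\|\theta_\varepsilon^{c}-\bar\theta\|_{\mathcal D})$ as $\varepsilon\downarrow0$.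
   Context: **Setting.** $\mathcal X,\mathcal Y,\mathcal H$ are finite-dimensional real Hilbert spaces, $\mathcal K\subseteq\mathcal X$ is a closed convex cone with dual cone $\mathcal K^*$. A parameter is $\theta=(\mathcal A,b,c)\in\mathcal D:=\mathcal L(\mathcal X,\mathcal Y)\times\mathcal Y\times\mathcal X$ (with $\mathcal L(\mathcal X,\mathcal Y)$ the linear maps), normed by $\|\theta\|_{\mathcal D}^2:=\|\mathcal A\|_{\mathrm{HS}}^2+\|b\|_{\mathcal Y}^2+\|c\|_{\mathcal X}^2$. Put $\mathrm{KKT}(\theta):=\{(x,y,s):\mathcal Ax=b,\ \mathcal A^*y+s=c,\ \langle x,s\rangle_{\mathcal X}=0,\ x\in\mathcal K,\ s\in\mathcal K^*\}$ and $\mathcal D_{\mathrm{KKT}}:=\{\theta\in\mathcal D:\mathrm{KKT}(\theta)\ne\emptyset\}$. Let $\bar\theta\in\mathrm{cl}(\mathcal D_{\mathrm{KKT}})$ and let $U\subset\mathcal D$ be compact with $\bar\theta\in U$. To each $\theta\in U$ is associated a map $T_\theta:\mathcal H\to\mathcal H$, with residual map $\delta_\theta:=T_\theta-\mathrm{Id}$ and fixed point set $\mathrm{Fix}(T_\theta)$. **Standing assumptions.** (i) For every $\theta\in U$: $\mathrm{Fix}(T_\theta)\ne\emptyset$ iff $\theta\in\mathcal D_{\mathrm{KKT}}$. (ii) For every $\theta\in U$, $T_\theta$ is $\alpha_\theta$-averaged for some $\alpha_\theta\in(0,1)$ (i.e. $T_\theta=(1-\alpha_\theta)\mathrm{Id}+\alpha_\theta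 N_\theta$ with $N_\theta$ nonexpansive) with respect to the inner product $\langle z,w\rangle_\theta:=\langle z,G_\theta w\rangle_{\mathcal H}$, $G_\theta$ self-adjoint positive definite on $\mathcal H$. (iii) There are $0<m_U\le M_U<\infty$ with $m_U\mathrm{Id}\preceq G_\theta\preceq M_U\mathrm{Id}$ for all $\theta\in U$. (iv) There is $L_U(r)=a+a'r$ with $a,a'\ge0$ such that $\|T_\theta z-T_{\theta'}z\|_{\mathcal H}\le L_U(\|z\|_{\mathcal H})\,\|\theta-\theta'\|_{\mathcal D}$ for all $\theta,\theta'\in U$, $z\in\mathcal H$. **Drift and tag.** For $\theta\in U$, the forward drift $v_\theta$ is the projection of $0$ onto the closed convex set $\mathrm{cl}(\mathrm{ran}(\delta_\theta))$ in the norm $\|\cdot\|_\theta$. $\mathrm{tag}(\theta)\in\{0,+\}\times\{\mathrm{fin},\mathrm{inf}\}$: the first entry is $0$ iff $v_\theta=0$; the second is $\mathrm{fin}$ iff $v_\theta\in\mathrm{ran}(\delta_\theta)$. (So $\mathrm{tag}(\theta)=(0,\mathrm{fin})$ iff $\mathrm{Fix}(T_\theta)\neq\emptyset$.) **Families.** All conditions on families indexed by $\varepsilon\downarrow0$ are required only for all sufficiently small $\varepsilon>0$. A center family is $\{\theta_\varepsilon^{c}\}_{\varepsilon\downarrow0}\subset U\cap\mathcal D_{\mathrm{KKT}}$ with $\theta_\varepsilon^{c}\to\bar\theta$; a petal family is $\{\theta_\varepsilon^{p}\}_{\varepsilon\downarrow0}\subset U$ with $\theta_\varepsilon^{p}\to\bar\theta$.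 Write $\delta_\varepsilon^{c}:=\delta_{\theta_\varepsilon^{c}}$, $\delta_\varepsilon^{p}:=\delta_{\theta_\varepsilon^{p}}$, $v_\varepsilon^{p}:=v_{\theta_\varepsilon^{p}}$, $V_\varepsilon^{c}:=\mathrm{Fix}(T_{\theta_\varepsilon^{c}})$. $\mathrm{dist}_{\mathcal H}$ is the distance in $\|\cdot\|_{\mathcal H}$. **Slow region (SR) family.** $\{\mathcal S_\varepsilon\}_{\varepsilon\downarrow0}$, $\mathcal S_\varepsilon\subset\mathcal H$, is an SR family of $\{\theta_\varepsilon^{c}\}$ iff (1) $\mathcal S_\varepsilon\ne\emptyset$ and $\mathcal S_\varepsilon\cap V_\varepsilon^{c}=\emptyset$; (2) its vanishing modulus $\rho_\varepsilon:=\sup_{z\in\mathcal S_\varepsilon}\|\delta_\varepsilon^{c}(z)\|_{\mathcal H}/\mathrm{dist}_{\mathcal H}(z,V_\varepsilon^{c})$ is finite and $\rho_\varepsilon\to0$. **Afterimage slow region (ASR) family.** An SR family $\{\mathcal S_\varepsilon\}$ of $\{\theta_\varepsilon^{c}\}$ is an ASR family with respect to a petal family $\{\theta_\varepsilon^{p}\}$ iff there are $\mu_\varepsilon\ge0$ with $\mu_\varepsilon\to0$ and $\|\delta_\varepsilon^{p}(z)-v_\varepsilon^{p}\|_{\mathcal H}\le\mu_\varepsilon$ for all $z\in\mathcal S_\varepsilon$. A face of a convex set $C$ is a convex subset $F\subseteq C$ such that whenever $z,w\in C$ and $tz+(1-t)w\in F$ for some $t\in(0,1)$, then $z,w\in F$;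 it is proper if $F\ne C$. *)

theory Defs
  imports "HOL-Analysis.Analysis" "HOL-Library.Landau_Symbols"
begin

section \<open>Linear maps with the Hilbert--Schmidt inner product\<close>

text \<open>
  The library type of bounded linear functions carries the operator norm. The parameter space
  here is normed with the Hilbert--Schmidt norm, so linear maps get a type of their own whose
  inner product is the Hilbert--Schmidt one. It does not depend on the orthonormal basis;
  \<^term>\<open>Basis\<close> is one choice.
\<close>

typedef (overloaded) ('x, 'y) lin_map = "{A :: 'x::euclidean_space \<Rightarrow> 'y::real_inner. linear A}"
  morphisms app_lin Lin_map
  by (rule exI[of _ "\<lambda>_. 0"]) (simp add: linear_zero)

setup_lifting type_definition_lin_map

lemma linear_app_lin: "linear (app_lin A)"
  using app_lin[of A] by simp

instantiation lin_map :: (euclidean_space, real_inner) real_vector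
begin

lift_definition zero_lin_map :: "('a, 'b) lin_map" is "\<lambda>_. 0"
  by (rule linear_zero)

lift_definition plus_lin_map :: "('a, 'b) lin_map \<Rightarrow> ('a, 'b) lin_map \<Rightarrow> ('a, 'b) lin_map"
  is "\<lambda>A B x. A x + B x"
  by (rule linear_compose_add)

lift_definition minus_lin_map :: "('a, 'b) lin_map \<Rightarrow> ('a, 'b) lin_map \<Rightarrow> ('a, 'b) lin_map"
  is "\<lambda>A B x. A x - B x"
  by (rule linear_compose_sub)

lift_definition uminus_lin_map :: "('a, 'b) lin_map \<Rightarrow> ('a, 'b) lin_map"
  is "\<lambda>A x. - A x"
  by (rule linear_compose_neg)

lift_definition scaleR_lin_map :: "real \<Rightarrow> ('a, 'b) lin_map \<Rightarrow> ('a, 'b) lin_map"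
  is "\<lambda>r A x. r *\<^sub>R A x"
  by (rule linear_compose_scale_right)

instance
proof
  fix A B C :: "('a, 'b) lin_map" and r s :: real
  show "A + B + C = A + (B + C)" by transfer (simp add: algebra_simps)
  show "A + B = B + A" by transfer (simp add: algebra_simps)
  show "0 + A = A" by transfer simp
  show "- A + A = 0" by transfer simp
  show "A - B = A + - B" by transfer simp
  show "r *\<^sub>R (A + B) = r *\<^sub>R A + r *\<^sub>R B" by transfer (simp add: scaleR_add_right)
  show "(r + s) *\<^sub>R A = r *\<^sub>R A + s *\<^sub>R A" by transfer (simp add: scaleR_add_left)
  show "r *\<^sub>R s *\<^sub>R A = (r * s) *\<^sub>R A" by transfer simp
  show "1 *\<^sub>R A = A" by transfer simp
qed

end

instantiation lin_map :: (euclidean_space, real_inner) real_inner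
begin

lift_definition inner_lin_map :: "('a, 'b) lin_map \<Rightarrow> ('a, 'b) lin_map \<Rightarrow> real"
  is "\<lambda>A B. \<Sum>e\<in>Basis. A e \<bullet> B e" .

definition norm_lin_map :: "('a, 'b) lin_map \<Rightarrow> real"
  where "norm_lin_map A = sqrt (inner A A)"

definition dist_lin_map :: "('a, 'b) lin_map \<Rightarrow> ('a, 'b) lin_map \<Rightarrow> real"
  where "dist_lin_map A B = norm (A - B)"

definition sgn_lin_map :: "('a, 'b) lin_map \<Rightarrow> ('a, 'b) lin_map"
  where "sgn_lin_map A = A /\<^sub>R norm A"

definition uniformity_lin_map :: "(('a, 'b) lin_map \<times> ('a, 'b) lin_map) filter"
  where "uniformity_lin_map = (INF e\<in>{0<..}. principal {(A, B). dist A B < e})"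

definition open_lin_map :: "('a, 'b) lin_map set \<Rightarrow> bool"
  where "open_lin_map S \<longleftrightarrow>
    (\<forall>A\<in>S. eventually (\<lambda>(A', B). A' = A \<longrightarrow> B \<in> S) uniformity)"

instance
proof
  fix A B C :: "('a, 'b) lin_map" and r :: real and S :: "('a, 'b) lin_map set"
  show "dist A B = norm (A - B)" by (rule dist_lin_map_def)
  show "sgn A = A /\<^sub>R norm A" by (rule sgn_lin_map_def)
  show "(uniformity :: (('a, 'b) lin_map \<times> ('a, 'b) lin_map) filter)
      = (INF e\<in>{0<..}. principal {(A, B). dist A B < e})"
    by (rule uniformity_lin_map_def)
  show "open S \<longleftrightarrow> (\<forall>A\<in>S. \<forall>\<^sub>F (A', B) in uniformity. A' = A \<longrightarrow> B \<in> S)"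
    by (rule open_lin_map_def)
  show "A \<bullet> B = B \<bullet> A" by transfer (simp add: inner_commute)
  show "(A + B) \<bullet> C = A \<bullet> C + B \<bullet> C"
    by transfer (simp add: inner_add_left sum.distrib)
  show "r *\<^sub>R A \<bullet> B = r * (A \<bullet> B)" by transfer (simp add: sum_distrib_left)
  show "0 \<le> A \<bullet> A" by transfer (simp add: sum_nonneg)
  show "(A \<bullet> A = 0) = (A = 0)"
  proof (transfer, safe)
    fix A :: "'a \<Rightarrow> 'b"
    assume lin: "linear A" and "(\<Sum>e\<in>Basis. A e \<bullet> A e) = 0"
    then have "\<And>e. e \<in> Basis \<Longrightarrow> A e = 0"
      by (simp add: sum_nonneg_eq_0_iff)
    then show "A = (\<lambda>_. 0)"
      by (intro linear_eq_stdbasis[OF lin linear_zero])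
  qed simp
  show "norm A = sqrt (A \<bullet> A)" by (rule norm_lin_map_def)
qed

end


section \<open>Parameters and KKT points\<close>

text \<open>
  A parameter is a triple \<open>(A, b, c)\<close>; the norm of the product type is the square root of
  the sum of the squared norms of the components.
\<close>

type_synonym ('x, 'y) param = "('x, 'y) lin_map \<times> 'y \<times> 'x"

definition dual_cone :: "'x::real_inner set \<Rightarrow> 'x set"
  where "dual_cone K = {s. \<forall>x\<in>K. 0 \<le> x \<bullet> s}"

definition KKT ::
    "'x::euclidean_space set \<Rightarrow> ('x, 'y::euclidean_space) param \<Rightarrow> ('x \<times> 'y \<times> 'x) set"
  where "KKT K \<theta> = (case \<theta> of (A, b, c) \<Rightarrow>
    {(x, y, s). app_lin A x = b \<and> adjoint (app_lin A) y + s = c \<and> x \<bullet> s = 0 \<and>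
                x \<in> K \<and> s \<in> dual_cone K})"

definition D_KKT :: "'x::euclidean_space set \<Rightarrow> ('x, 'y::euclidean_space) param set"
  where "D_KKT K = {\<theta>. KKT K \<theta> \<noteq> {}}"


section \<open>Averaged maps, drift and tag\<close>

definition residual :: "('h::real_vector \<Rightarrow> 'h) \<Rightarrow> 'h \<Rightarrow> 'h"
  where "residual T z = T z - z"

definition Fix :: "('h \<Rightarrow> 'h) \<Rightarrow> 'h set"
  where "Fix T = {z. T z = z}"

definition self_adjoint_pos_def :: "('h::real_inner \<Rightarrow> 'h) \<Rightarrow> bool"
  where "self_adjoint_pos_def G \<longleftrightarrow>
    linear G \<and> (\<forall>z w. G z \<bullet> w = z \<bullet> G w) \<and> (\<forall>z. z \<noteq> 0 \<longrightarrow> 0 < z \<bullet> G z)"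

definition gnorm :: "('h::real_inner \<Rightarrow> 'h) \<Rightarrow> 'h \<Rightarrow> real"
  where "gnorm G z = sqrt (z \<bullet> G z)"

definition averaged :: "('h::real_inner \<Rightarrow> 'h) \<Rightarrow> real \<Rightarrow> ('h \<Rightarrow> 'h) \<Rightarrow> bool"
  where "averaged G \<alpha> T \<longleftrightarrow>
    (\<exists>N. (\<forall>z w. gnorm G (N z - N w) \<le> gnorm G (z - w)) \<and>
         (\<forall>z. T z = (1 - \<alpha>) *\<^sub>R z + \<alpha> *\<^sub>R N z))"

text \<open>
  Projection of \<open>0\<close> onto the closed range of the residual in the norm given by \<open>G\<close>. For averaged
  \<open>T\<close> this set is nonempty, closed and convex, so the minimiser exists and is unique.
\<close>

definition drift :: "('h::real_inner \<Rightarrow> 'h) \<Rightarrow> ('h \<Rightarrow> 'h) \<Rightarrow> 'h"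
  where "drift G T = arg_min_on (gnorm G) (closure (range (residual T)))"

datatype drift_tag = Tag_zero | Tag_plus
datatype attain_tag = Tag_fin | Tag_inf

definition tag :: "('h::real_inner \<Rightarrow> 'h) \<Rightarrow> ('h \<Rightarrow> 'h) \<Rightarrow> drift_tag \<times> attain_tag"
  where "tag G T =
    (if drift G T = 0 then Tag_zero else Tag_plus,
     if drift G T \<in> range (residual T) then Tag_fin else Tag_inf)"


section \<open>Standing assumptions\<close>

definition standing_assumptions ::
    "'x::euclidean_space set \<Rightarrow> ('x, 'y::euclidean_space) param set \<Rightarrow>
     (('x, 'y) param \<Rightarrow> 'h::euclidean_space \<Rightarrow> 'h) \<Rightarrow>
     (('x, 'y) param \<Rightarrow> 'h \<Rightarrow> 'h) \<Rightarrow> bool"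
  where "standing_assumptions K U G T \<longleftrightarrow>
    (\<forall>\<theta>\<in>U. Fix (T \<theta>) \<noteq> {} \<longleftrightarrow> \<theta> \<in> D_KKT K) \<and>
    (\<forall>\<theta>\<in>U. self_adjoint_pos_def (G \<theta>) \<and>
           (\<exists>\<alpha>. 0 < \<alpha> \<and> \<alpha> < 1 \<and> averaged (G \<theta>) \<alpha> (T \<theta>))) \<and>
    (\<exists>m M. 0 < m \<and> m \<le> M \<and>
       (\<forall>\<theta>\<in>U. \<forall>z. m * (z \<bullet> z) \<le> z \<bullet> G \<theta> z \<and> z \<bullet> G \<theta> z \<le> M * (z \<bullet> z))) \<and>
    (\<exists>a a'. 0 \<le> a \<and> 0 \<le> a' \<and>
       (\<forall>\<theta>\<in>U. \<forall>\<theta>'\<in>U. \<forall>z.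
          norm (T \<theta> z - T \<theta>' z) \<le> (a + a' * norm z) * norm (\<theta> - \<theta>')))"


section \<open>Families\<close>

text \<open>
  A family indexed by \<open>\<epsilon>\<close> decreasing to \<open>0\<close> is a function of a real argument of which only the
  germ at \<open>0\<close> from the right matters: every condition is imposed along \<^term>\<open>at_right (0::real)\<close>.
\<close>

definition center_family ::
    "'x::euclidean_space set \<Rightarrow> ('x, 'y::euclidean_space) param set \<Rightarrow> ('x, 'y) param \<Rightarrow>
     (real \<Rightarrow> ('x, 'y) param) \<Rightarrow> bool"
  where "center_family K U \<theta>bar \<theta>c \<longleftrightarrow>
    (\<forall>\<^sub>F \<epsilon> in at_right 0. \<theta>c \<epsilon> \<in> U \<inter> D_KKT K) \<and> (\<theta>c \<longlongrightarrow> \<theta>bar) (at_right 0)"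

definition petal_family ::
    "('x::euclidean_space, 'y::euclidean_space) param set \<Rightarrow> ('x, 'y) param \<Rightarrow>
     (real \<Rightarrow> ('x, 'y) param) \<Rightarrow> bool"
  where "petal_family U \<theta>bar \<theta>p \<longleftrightarrow>
    (\<forall>\<^sub>F \<epsilon> in at_right 0. \<theta>p \<epsilon> \<in> U) \<and> (\<theta>p \<longlongrightarrow> \<theta>bar) (at_right 0)"

text \<open>
  Painleve--Kuratowski limits of a family of sets along a filter. The neighbourhood form is used
  because \<^const>\<open>infdist\<close> to the empty set is \<open>0\<close>.
\<close>

definition PK_inner :: "('i \<Rightarrow> 'a::topological_space set) \<Rightarrow> 'i filter \<Rightarrow> 'a set"
  where "PK_inner V \<F> = {z. \<forall>W. open W \<and> z \<in> W \<longrightarrow> (\<forall>\<^sub>F i in \<F>. V i \<inter> W \<noteq> {})}"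

definition PK_outer :: "('i \<Rightarrow> 'a::topological_space set) \<Rightarrow> 'i filter \<Rightarrow> 'a set"
  where "PK_outer V \<F> = {z. \<forall>W. open W \<and> z \<in> W \<longrightarrow> (\<exists>\<^sub>F i in \<F>. V i \<inter> W \<noteq> {})}"

definition PK_converges ::
    "('i \<Rightarrow> 'a::topological_space set) \<Rightarrow> 'a set \<Rightarrow> 'i filter \<Rightarrow> bool"
  where "PK_converges V F \<F> \<longleftrightarrow> PK_inner V \<F> = F \<and> PK_outer V \<F> = F"


section \<open>Slow regions and afterimage slow regions\<close>

text \<open>
  In the definitions below the set \<open>Fix T\<close> is nonempty (center parameters lie in \<^const>\<open>D_KKT\<close>)
  and closed, and it is disjoint from \<open>S\<close>, so the denominators are positive.
\<close>

definition slow_ratio :: "('h::real_normed_vector \<Rightarrow> 'h) \<Rightarrow> 'h \<Rightarrow> real"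
  where "slow_ratio T z = norm (residual T z) / infdist z (Fix T)"

text \<open>A real supremum; its finiteness is the condition \<^const>\<open>bdd_above\<close> in the next definition.\<close>

definition vanishing_modulus :: "('h::real_normed_vector \<Rightarrow> 'h) \<Rightarrow> 'h set \<Rightarrow> real"
  where "vanishing_modulus T S = (SUP z\<in>S. slow_ratio T z)"

definition SR_family ::
    "'x::euclidean_space set \<Rightarrow> ('x, 'y::euclidean_space) param set \<Rightarrow>
     (('x, 'y) param \<Rightarrow> 'h::euclidean_space \<Rightarrow> 'h) \<Rightarrow> ('x, 'y) param \<Rightarrow>
     (real \<Rightarrow> ('x, 'y) param) \<Rightarrow> (real \<Rightarrow> 'h set) \<Rightarrow> bool"
  where "SR_family K U T \<theta>bar \<theta>c S \<longleftrightarrow>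
    center_family K U \<theta>bar \<theta>c \<and>
    (\<forall>\<^sub>F \<epsilon> in at_right 0. S \<epsilon> \<noteq> {} \<and> S \<epsilon> \<inter> Fix (T (\<theta>c \<epsilon>)) = {}) \<and>
    (\<forall>\<^sub>F \<epsilon> in at_right 0. bdd_above (slow_ratio (T (\<theta>c \<epsilon>)) ` S \<epsilon>)) \<and>
    ((\<lambda>\<epsilon>. vanishing_modulus (T (\<theta>c \<epsilon>)) (S \<epsilon>)) \<longlongrightarrow> 0) (at_right 0)"

definition ASR_family ::
    "'x::euclidean_space set \<Rightarrow> ('x, 'y::euclidean_space) param set \<Rightarrow>
     (('x, 'y) param \<Rightarrow> 'h::euclidean_space \<Rightarrow> 'h) \<Rightarrow>
     (('x, 'y) param \<Rightarrow> 'h \<Rightarrow> 'h) \<Rightarrow> ('x, 'y) param \<Rightarrow>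
     (real \<Rightarrow> ('x, 'y) param) \<Rightarrow> (real \<Rightarrow> ('x, 'y) param) \<Rightarrow> (real \<Rightarrow> 'h set) \<Rightarrow> bool"
  where "ASR_family K U G T \<theta>bar \<theta>c \<theta>p S \<longleftrightarrow>
    SR_family K U T \<theta>bar \<theta>c S \<and>
    petal_family U \<theta>bar \<theta>p \<and>
    (\<exists>\<mu>. (\<forall>\<^sub>F \<epsilon> in at_right 0.
            0 \<le> \<mu> \<epsilon> \<and>
            (\<forall>z\<in>S \<epsilon>. norm (residual (T (\<theta>p \<epsilon>)) z - drift (G (\<theta>p \<epsilon>)) (T (\<theta>p \<epsilon>))) \<le> \<mu> \<epsilon>)) \<and>
         (\<mu> \<longlongrightarrow> 0) (at_right 0))"

end

theory Submission
  imports Defs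
begin

text \<open>
  On \<open>S\<close> the map at the limit parameter has residual zero, so the residual of the map at the centre
  parameter is exactly the perturbation \<open>T (\<theta>c \<epsilon>) z - T \<theta>bar z\<close>. The growth condition on the
  parameter dependence bounds it by a constant times \<open>norm (\<theta>c \<epsilon> - \<theta>bar)\<close>, uniformly on the bounded
  set \<open>S\<close>. It remains to keep the denominators of the slow ratios away from zero, which is
  \<open>PK_outer_eventually_infdist_ge\<close>: the fixed point sets at the centre parameters accumulate only
  on \<open>F\<close>, which has positive distance from \<open>S\<close>, and by compactness they must eventually leave a
  whole neighbourhood of \<open>S\<close>. A point of \<open>S\<close> is then an afterimage because it is fixed by the
  limit map, whose drift vanishes: the defect \<open>\<mu>\<close> is zero.
\<close>

text \<open>
  Each point outside the outer limit has a neighbourhood that the family eventually avoids; a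
  compact set is covered by finitely many of these.
\<close>

lemma PK_outer_eventually_disjoint_compact:
  assumes "compact C" and "C \<inter> PK_outer V \<F> = {}"
  shows "\<forall>\<^sub>F i in \<F>. V i \<inter> C = {}"
proof -
  have "\<exists>W. open W \<and> z \<in> W \<and> (\<forall>\<^sub>F i in \<F>. V i \<inter> W = {})" if "z \<in> C" for z
    using that assms(2) by (auto simp: PK_outer_def frequently_def)
  then obtain W where W: "\<And>z. z \<in> C \<Longrightarrow> open (W z)" "\<And>z. z \<in> C \<Longrightarrow> z \<in> W z"
      "\<And>z. z \<in> C \<Longrightarrow> \<forall>\<^sub>F i in \<F>. V i \<inter> W z = {}"
    by metis
  obtain D where D: "D \<subseteq> C" "finite D" "C \<subseteq> (\<Union>z\<in>D. W z)"
    using compactE_image[OF assms(1), of C W] W(1,2) by blast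
  have "\<forall>\<^sub>F i in \<F>. \<forall>z\<in>D. V i \<inter> W z = {}"
    using D W(3) by (intro eventually_ball_finite) auto
  then show ?thesis
    by eventually_elim (use D(3) in blast)
qed

text \<open>
  Because \<open>r < d\<close>, the closed \<open>r\<close>-neighbourhood of \<open>S\<close> misses \<open>F\<close>. It is compact, so the family
  eventually avoids all of it, which bounds the distance to every point of \<open>S\<close> with the same \<open>r\<close>.
\<close>

lemma PK_outer_eventually_infdist_ge:
  fixes V :: "'i \<Rightarrow> 'a::heine_borel set"
  assumes outer: "PK_outer V \<F> \<subseteq> F" and "bounded S" and "0 < r" and "r < d"
    and far: "\<And>z. z \<in> S \<Longrightarrow> d \<le> infdist z F"
    and ne: "\<forall>\<^sub>F i in \<F>. V i \<noteq> {}"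
  shows "\<forall>\<^sub>F i in \<F>. S \<inter> V i = {} \<and> (\<forall>z\<in>S. r \<le> infdist z (V i))"
proof (cases "S = {}")
  case False
  define C where "C = {w. infdist w S \<le> r}"
  have "compact {w. infdist w (closure S) \<le> r}"
    using \<open>bounded S\<close> \<open>0 < r\<close> False by (intro compact_infdist_le) (auto simp: compact_closure)
  moreover have "C \<subseteq> {w. infdist w (closure S) \<le> r}"
    unfolding C_def using infdist_mono[OF closure_subset False] order_trans by blast
  moreover have "closed C"
    unfolding C_def by (intro closed_Collect_le continuous_intros)
  ultimately have "compact C"
    using bounded_subset compact_eq_bounded_closed by blast
  moreover have "C \<inter> PK_outer V \<F> = {}"
  proof -
    have "d \<le> infdist f S" if "f \<in> F" for f
      unfolding infdist_notempty[OF False]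
    proof (rule cINF_greatest[OF False])
      fix z assume "z \<in> S"
      then show "d \<le> dist f z"
        using far infdist_le[OF that, of z] by (fastforce simp: dist_commute)
    qed
    then show ?thesis
      using outer \<open>r < d\<close> by (force simp: C_def)
  qed
  ultimately have "\<forall>\<^sub>F i in \<F>. V i \<inter> C = {}"
    by (rule PK_outer_eventually_disjoint_compact)
  then show ?thesis
    using ne
  proof eventually_elim
    case (elim i)
    have "r \<le> infdist z (V i)" if "z \<in> S" for z
      unfolding infdist_notempty[OF elim(2)]
    proof (rule cINF_greatest[OF elim(2)])
      fix v assume "v \<in> V i"
      then have "r < infdist v S"
        using elim(1) by (auto simp: C_def)
      then show "r \<le> dist z v"
        using infdist_le[OF that, of v] by (simp add: dist_commute)
    qed
    moreover have "S \<subseteq> C"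
      using \<open>0 < r\<close> by (auto simp: C_def)
    ultimately show ?case
      using elim(1) by blast
  qed
qed simp

text \<open>
  At a fixed point of \<open>T0\<close> the residual of \<open>T\<close> is the perturbation \<open>T z - T0 z\<close>.
\<close>

lemma slow_ratio_le_perturbation:
  assumes "T0 z = z" and "norm (T z - T0 z) \<le> e" and "0 < r" and "r \<le> infdist z (Fix T)"
  shows "slow_ratio T z \<le> e / r"
proof -
  have "norm (residual T z) \<le> e"
    using assms(1,2) by (simp add: residual_def)
  then show ?thesis
    unfolding slow_ratio_def using assms(3,4) order_trans[OF norm_ge_zero]
    by (intro frac_le) auto
qed

lemma slow_ratio_nonneg: "0 \<le> slow_ratio T z"
  by (simp add: slow_ratio_def infdist_nonneg)

lemma vanishing_modulus_bounds:
  assumes "S \<noteq> {}" and "\<And>z. z \<in> S \<Longrightarrow> slow_ratio T z \<le> e"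
  shows "bdd_above (slow_ratio T ` S)" and "0 \<le> vanishing_modulus T S"
    and "vanishing_modulus T S \<le> e"
proof -
  show bdd: "bdd_above (slow_ratio T ` S)"
    using assms(2) by (rule bdd_aboveI2)
  obtain z where "z \<in> S"
    using assms(1) by blast
  then show "0 \<le> vanishing_modulus T S"
    unfolding vanishing_modulus_def
    by (intro order_trans[OF slow_ratio_nonneg cSUP_upper[OF _ bdd]])
  show "vanishing_modulus T S \<le> e"
    unfolding vanishing_modulus_def using assms by (rule cSUP_least)
qed

theorem theorem2p9:
  fixes K :: "'x::euclidean_space set"
    and U :: "('x, 'y::euclidean_space) param set"
    and G T :: "('x, 'y) param \<Rightarrow> 'h::euclidean_space \<Rightarrow> 'h"
    and \<theta>bar :: "('x, 'y) param"
    and \<theta>c :: "real \<Rightarrow> ('x, 'y) param"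
    and F S :: "'h set"
  assumes "closed K" and "convex_cone K"
    and "\<theta>bar \<in> closure (D_KKT K)"
    and "compact U" and "\<theta>bar \<in> U"
    and "standing_assumptions K U G T"
    and "tag (G \<theta>bar) (T \<theta>bar) = (Tag_zero, Tag_fin)"
    and "center_family K U \<theta>bar \<theta>c"
    and "PK_converges (\<lambda>\<epsilon>. Fix (T (\<theta>c \<epsilon>))) F (at_right 0)"
    and "F face_of Fix (T \<theta>bar)" and "F \<noteq> {}" and "F \<noteq> Fix (T \<theta>bar)"
    and "S \<subseteq> Fix (T \<theta>bar)" and "S \<noteq> {}" and "bounded S"
    and "0 < (INF z\<in>S. infdist z F)"
  shows "ASR_family K U G T \<theta>bar \<theta>c (\<lambda>_. \<theta>bar) (\<lambda>_. S) \<and>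
         (\<lambda>\<epsilon>. vanishing_modulus (T (\<theta>c \<epsilon>)) S) \<in> O[at_right 0](\<lambda>\<epsilon>. norm (\<theta>c \<epsilon> - \<theta>bar))"
proof -
  obtain a a' where a: "0 \<le> a" "0 \<le> a'"
    and lip: "\<And>\<theta> \<theta>' z. \<theta> \<in> U \<Longrightarrow> \<theta>' \<in> U \<Longrightarrow>
      norm (T \<theta> z - T \<theta>' z) \<le> (a + a' * norm z) * norm (\<theta> - \<theta>')"
    using assms(6) unfolding standing_assumptions_def by meson
  obtain B where B: "\<And>z. z \<in> S \<Longrightarrow> norm z \<le> B"
    using \<open>bounded S\<close> by (auto simp: bounded_iff)
  define d where "d = (INF z\<in>S. infdist z F)"
  define C where "C = (a + a' * B) / (d / 2)"
  have "0 < d"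
    using assms(16) by (simp add: d_def)
  have far: "d \<le> infdist z F" if "z \<in> S" for z
    unfolding d_def by (rule cINF_lower) (auto intro!: bdd_belowI2 infdist_nonneg that)

  have inU: "\<forall>\<^sub>F \<epsilon> in at_right 0. \<theta>c \<epsilon> \<in> U \<inter> D_KKT K" and lim: "(\<theta>c \<longlongrightarrow> \<theta>bar) (at_right 0)"
    using assms(8) by (auto simp: center_family_def)
  have "\<forall>\<^sub>F \<epsilon> in at_right 0. Fix (T (\<theta>c \<epsilon>)) \<noteq> {}"
    using inU by eventually_elim (use assms(6) in \<open>auto simp: standing_assumptions_def\<close>)
  then have sep: "\<forall>\<^sub>F \<epsilon> in at_right 0. S \<inter> Fix (T (\<theta>c \<epsilon>)) = {} \<and>
      (\<forall>z\<in>S. d / 2 \<le> infdist z (Fix (T (\<theta>c \<epsilon>))))"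
    using assms(9) \<open>bounded S\<close> \<open>0 < d\<close> far
    by (intro PK_outer_eventually_infdist_ge[where F = F and d = d]) (auto simp: PK_converges_def)
  have ratio: "\<forall>\<^sub>F \<epsilon> in at_right 0. \<forall>z\<in>S. slow_ratio (T (\<theta>c \<epsilon>)) z \<le> C * norm (\<theta>c \<epsilon> - \<theta>bar)"
    using inU sep
  proof eventually_elim
    case (elim \<epsilon>)
    show ?case
    proof
      fix z assume z: "z \<in> S"
      have "norm (T (\<theta>c \<epsilon>) z - T \<theta>bar z) \<le> (a + a' * norm z) * norm (\<theta>c \<epsilon> - \<theta>bar)"
        using elim(1) \<open>\<theta>bar \<in> U\<close> by (intro lip) auto
      also have "\<dots> \<le> (a + a' * B) * norm (\<theta>c \<epsilon> - \<theta>bar)"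
        using a B[OF z] by (intro mult_right_mono add_left_mono mult_left_mono) auto
      finally have "slow_ratio (T (\<theta>c \<epsilon>)) z \<le> (a + a' * B) * norm (\<theta>c \<epsilon> - \<theta>bar) / (d / 2)"
        using z elim(2) \<open>0 < d\<close> \<open>S \<subseteq> Fix (T \<theta>bar)\<close>
        by (intro slow_ratio_le_perturbation[where ?T0.0 = "T \<theta>bar"]) (auto simp: Fix_def)
      then show "slow_ratio (T (\<theta>c \<epsilon>)) z \<le> C * norm (\<theta>c \<epsilon> - \<theta>bar)"
        by (simp only: C_def times_divide_eq_left)
    qed
  qed
  have bdd: "\<forall>\<^sub>F \<epsilon> in at_right 0. bdd_above (slow_ratio (T (\<theta>c \<epsilon>)) ` S)"
    using ratio by eventually_elim (rule vanishing_modulus_bounds(1)[OF \<open>S \<noteq> {}\<close>], rule bspec)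
  have nonneg: "\<forall>\<^sub>F \<epsilon> in at_right 0. 0 \<le> vanishing_modulus (T (\<theta>c \<epsilon>)) S"
    using ratio by eventually_elim (rule vanishing_modulus_bounds(2)[OF \<open>S \<noteq> {}\<close>], rule bspec)
  have upper: "\<forall>\<^sub>F \<epsilon> in at_right 0.
      vanishing_modulus (T (\<theta>c \<epsilon>)) S \<le> C * norm (\<theta>c \<epsilon> - \<theta>bar)"
    using ratio by eventually_elim (rule vanishing_modulus_bounds(3)[OF \<open>S \<noteq> {}\<close>], rule bspec)

  have "((\<lambda>\<epsilon>. C * norm (\<theta>c \<epsilon> - \<theta>bar)) \<longlongrightarrow> C * norm (\<theta>bar - \<theta>bar)) (at_right 0)"
    by (intro tendsto_intros lim)
  then have "((\<lambda>\<epsilon>. C * norm (\<theta>c \<epsilon> - \<theta>bar)) \<longlongrightarrow> 0) (at_right 0)"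
    by simp
  then have vanish: "((\<lambda>\<epsilon>. vanishing_modulus (T (\<theta>c \<epsilon>)) S) \<longlongrightarrow> 0) (at_right 0)"
    by (rule tendsto_sandwich[OF nonneg upper tendsto_const])
  have SR: "SR_family K U T \<theta>bar \<theta>c (\<lambda>_. S)"
    unfolding SR_family_def using assms(8) \<open>S \<noteq> {}\<close> bdd vanish
    by (auto intro: eventually_mono[OF sep])

  have "drift (G \<theta>bar) (T \<theta>bar) = 0"
    using assms(7) by (auto simp: tag_def split: if_splits)
  then have "norm (residual (T \<theta>bar) z - drift (G \<theta>bar) (T \<theta>bar)) \<le> 0" if "z \<in> S" for z
    using that \<open>S \<subseteq> Fix (T \<theta>bar)\<close> by (auto simp: residual_def Fix_def)
  then have "ASR_family K U G T \<theta>bar \<theta>c (\<lambda>_. \<theta>bar) (\<lambda>_. S)"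
    unfolding ASR_family_def petal_family_def using SR \<open>\<theta>bar \<in> U\<close>
    by (auto intro!: exI[of _ "\<lambda>_. 0"])
  moreover have "(\<lambda>\<epsilon>. vanishing_modulus (T (\<theta>c \<epsilon>)) S) \<in> O[at_right 0](\<lambda>\<epsilon>. norm (\<theta>c \<epsilon> - \<theta>bar))"
    by (rule bigoI[of _ C]) (use nonneg upper in \<open>eventually_elim, simp\<close>)
  ultimately show ?thesis ..
qed

end
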